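(* Let $\mathbf c$ be a rectifiable curve in $\mathbb R^{N+1}$ such that $\mathcal F_p(\mathbf c)<\infty$ for some $p>1$. Then $\mathcal F_q(\mathbf c)<\infty$ for all $1\le q<p$, and $$\mathcal F_q(\mathbf c)\le\mathcal L(\mathbf c)+\mathcal F_p(\mathbf c).$$ In particular, $\mathbf c$ has finite total curvature, $\mathrm{TC}(\mathbf c)<\infty$.
   Context: $N\ge1$ is an integer; the rectifiable curve $\mathbf c:[0,L]\to\mathbb R^{N+1}$ is parameterized in arc-length, and $L=\mathcal L(\mathbf c)$ is its length. Inscribed polygonals and modulus. A polygonal $P$ is inscribed in $\mathbf c$, written $P\ll\mathbf c$, if there is a finite partition $0=t_0<t_1<\dots<t_n=L$ such that $P$ is the polygonal with consecutive vertices $\mathbf c(t_0),\dots,\mathbf c(t_n)$. The modulus $\mu_{\mathbf c}(P)$ is the maximum of the diameters of the arcs of $\mathbf c$ determined by consecutive vertices of $P$. $\{P_h\}\ll\mathbf c$ means that $\{P_h\}$ is a sequence of polygonals each inscribed in $\mathbf c$. Rotation and total curvature. For a polygonal $P$ with non-degenerate consecutive segments, the turning (exterior) angle between consecutive segments $\mathbf v_i,\mathbf v_{i+1}$ of lengths $\ell_i,\ell_{i+1}>0$ is $\theta_i=\arccos\big(\frac{\mathbf v_i\bullet\mathbf v_{i+1}}{\ell_i\ell_{i+1}}\big)\in[0,\pi]$; the rotation $\mathbf k^*(P)$ is the sum of all turning angles (including, if $P$ is closed, the one between the last and first segments). The total curvature is $\mathrm{TC}(\mathbf c)=\sup\{\mathbf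 k^*(P): P\ll\mathbf c\}$. $p$-rotation. Let $P$ be an open polygonal with $n$ non-degenerate consecutive segments $\mathbf v_1,\dots,\mathbf v_n$ of lengths $\ell_i$, $v_i$ the common vertex of $\mathbf v_i$ and $\mathbf v_{i+1}$, and turning angles $\theta_i<\pi$, $i=1,\dots,n-1$. Let $r_i=\min\{\ell_i,\ell_{i+1}\}$ and let $t_i^-\in\mathbf v_i$, $t_i^+\in\mathbf v_{i+1}$ be the points at distance $r_i/2$ from $v_i$. If $\theta_i>0$ let $\gamma_i$ be the oriented circular arc from $t_i^-$ to $t_i^+$ tangent to $\mathbf v_i$ at $t_i^-$ and to $\mathbf v_{i+1}$ at $t_i^+$ (radius $(r_i/2)/\tan(\theta_i/2)$, total angle $\theta_i$); if $\theta_i=0$ let $\gamma_i$ be the segment from $t_i^-$ to $t_i^+$. Let $\gamma(P)$ run consecutively through $\gamma_1$, the segment from $t_1^+$ to $t_2^-$, $\gamma_2$, ..., $\gamma_{n-1}$. For $p\ge1$ the $p$-rotation $\mathbf k_p(P)$ is the integral over $\gamma(P)$, in arc-length, of the $p$-th power of its scalar curvature, i.e. $\mathbf k_p(P)=\sum_{i=1}^{n-1}\theta_i\big(\frac{\tan(\theta_i/2)}{r_i/2}\big)^{p-1}$. If $P$ is closed, the vertex $v_n=v_0$ is treated in the same way and contributes too. If some turning angle of $P$ equals $\pi$, then $\mathbf k_p(P)=+\infty$ for $p>1$; $\mathbf k_1(P)=\mathbf k^*(P)$ always. $p$-curvature. For $p\ge1$, $\mathcal F_p(\mathbf c):=\inf\{\liminf_{h\to\infty}\mathbf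 k_p(P_h)\mid\{P_h\}\ll\mathbf c,\ \mu_{\mathbf c}(P_h)\to0\}$. *)

theory Defs
  imports "HOL-Analysis.Analysis"
begin

section \<open>Polygonals\<close>

text \<open>A polygonal is given by the list \<open>P\<close> of its vertices \<open>P ! 0, \<dots>, P ! n\<close>, where \<open>n\<close> is the
  number of its segments. The segment \<open>i\<close> below runs from \<open>P ! i\<close> to \<open>P ! Suc i\<close>; thus segments
  are counted from 0.\<close>

definition n_segments :: "'a list \<Rightarrow> nat" where
  "n_segments P = length P - 1"

definition segment :: "'a::real_inner list \<Rightarrow> nat \<Rightarrow> 'a" where
  "segment P i = P ! Suc i - P ! i"

definition polygonal_length :: "'a::real_inner list \<Rightarrow> real" where
  "polygonal_length P = (\<Sum>i<n_segments P. norm (segment P i))"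

definition nondegenerate :: "'a list \<Rightarrow> bool" where
  "nondegenerate P \<longleftrightarrow> (\<forall>i<n_segments P. P ! Suc i \<noteq> P ! i)"

definition closed_polygonal :: "'a list \<Rightarrow> bool" where
  "closed_polygonal P \<longleftrightarrow> hd P = last P"

text \<open>The corner \<open>i\<close> lies between the segment \<open>i\<close> and the segment \<open>next_segment P i\<close>. The corner
  between the last and the first segment is present only if the polygonal is closed.\<close>

definition next_segment :: "'a list \<Rightarrow> nat \<Rightarrow> nat" where
  "next_segment P i = Suc i mod n_segments P"

definition corners :: "'a list \<Rightarrow> nat set" where
  "corners P = {i. i < n_segments P \<and> (Suc i < n_segments P \<or> closed_polygonal P)}"

definition turning_angle :: "'a::real_inner list \<Rightarrow> nat \<Rightarrow> real" where
  "turning_angle P i =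
     (let v = segment P i; w = segment P (next_segment P i)
      in arccos (v \<bullet> w / (norm v * norm w)))"

definition rotation :: "'a::real_inner list \<Rightarrow> real" where
  "rotation P = (\<Sum>i\<in>corners P. turning_angle P i)"

definition corner_size :: "'a::real_inner list \<Rightarrow> nat \<Rightarrow> real" where
  "corner_size P i = min (norm (segment P i)) (norm (segment P (next_segment P i)))"

text \<open>Near corner \<open>i\<close>, with turning angle \<open>\<theta>\<close> and size \<open>r\<close>, the polygonal is replaced by a
  circular arc of radius \<open>(r / 2) / tan (\<theta> / 2)\<close> and total angle \<open>\<theta>\<close>; its length is \<open>\<theta>\<close> times the
  radius. Hence the integral in arc-length of the \<open>p\<close>-th power of the curvature over it is \<open>\<theta>\<close>
  times the curvature to the power \<open>p - 1\<close>. The rest of the smoothed curve is straight. The case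
  \<open>p = 1\<close> is separate because it is the rotation even if some turning angle is \<open>pi\<close>
  (and \<open>0 powr 0 = 0\<close> in HOL).\<close>

definition p_rotation :: "real \<Rightarrow> 'a::real_inner list \<Rightarrow> ereal" where
  "p_rotation p P =
     (if p = 1 then ereal (rotation P)
      else if \<exists>i\<in>corners P. turning_angle P i = pi then \<infinity>
      else ereal (\<Sum>i\<in>corners P. turning_angle P i *
                    (tan (turning_angle P i / 2) / (corner_size P i / 2)) powr (p - 1)))"


section \<open>Curves and inscribed polygonals\<close>

text \<open>For \<open>a = b\<close> the only partition is \<open>[a]\<close>, with no subinterval.\<close>

definition is_partition :: "real \<Rightarrow> real \<Rightarrow> real list \<Rightarrow> bool" where
  "is_partition a b ts \<longleftrightarrow> ts \<noteq> [] \<and> hd ts = a \<and> last ts = b \<and> sorted_wrt (<) ts"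

definition curve_length :: "(real \<Rightarrow> 'a::real_inner) \<Rightarrow> real \<Rightarrow> real \<Rightarrow> ereal" where
  "curve_length c a b = (SUP ts\<in>{ts. is_partition a b ts}. ereal (polygonal_length (map c ts)))"

definition rectifiable_curve :: "(real \<Rightarrow> 'a::real_inner) \<Rightarrow> real \<Rightarrow> bool" where
  "rectifiable_curve c L \<longleftrightarrow> continuous_on {0..L} c \<and> curve_length c 0 L < \<infinity>"

definition arc_length_parameterized :: "(real \<Rightarrow> 'a::real_inner) \<Rightarrow> real \<Rightarrow> bool" where
  "arc_length_parameterized c L \<longleftrightarrow> (\<forall>t\<in>{0..L}. curve_length c 0 t = ereal t)"

text \<open>The polygonal inscribed in \<open>c\<close> at the partition \<open>ts\<close> is \<open>map c ts\<close>. Since turning angles only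
  make sense for non-degenerate segments, partitions whose consecutive points have the same image
  are excluded. Merging repeated consecutive vertices instead would give the same total curvature
  and \<open>p\<close>-curvature, since it enlarges the modulus at most by a fixed factor.\<close>

definition inscribed :: "(real \<Rightarrow> 'a::real_inner) \<Rightarrow> real \<Rightarrow> real list \<Rightarrow> bool" where
  "inscribed c L ts \<longleftrightarrow> is_partition 0 L ts \<and> nondegenerate (map c ts)"

text \<open>The inserted \<open>0\<close> matters only for \<open>L = 0\<close>, where there are no arcs.\<close>

definition modulus :: "(real \<Rightarrow> 'a::real_inner) \<Rightarrow> real list \<Rightarrow> real" where
  "modulus c ts =
     Max (insert 0 ((\<lambda>i. diameter (c ` {ts ! i..ts ! Suc i})) ` {..<n_segments ts}))"

definition total_curvature :: "(real \<Rightarrow> 'a::real_inner) \<Rightarrow> real \<Rightarrow> ereal" where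
  "total_curvature c L = (SUP ts\<in>{ts. inscribed c L ts}. ereal (rotation (map c ts)))"

definition p_curvature :: "real \<Rightarrow> (real \<Rightarrow> 'a::real_inner) \<Rightarrow> real \<Rightarrow> ereal" where
  "p_curvature p c L =
     Inf {liminf (\<lambda>h. p_rotation p (map c (ts h))) | ts :: nat \<Rightarrow> real list.
            (\<forall>h. inscribed c L (ts h)) \<and> (\<lambda>h. modulus c (ts h)) \<longlonglongrightarrow> 0}"

end

theory Submission
  imports Defs "HOL-Library.Sublist"
begin

text \<open>On a circular arc of curvature \<open>\<kappa>\<close> one has \<open>\<kappa>\<^sup>q \<le> 1 + \<kappa>\<^sup>p\<close>, and the arcs replacing the corners of
  an inscribed polygonal are together no longer than the polygonal, hence no longer than the curve.
  This bounds the \<open>q\<close>-rotation of each polygonal by its \<open>p\<close>-rotation plus the length of the curve.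
  For the total curvature, take \<open>q = 1\<close>: there are inscribed polygonals of modulus tending to 0 and
  bounded rotation. An inscribed polygonal \<open>P\<close> is the limit of polygonals on suitable vertices of
  these. Removing vertices does not increase the rotation, by the triangle inequality for angles, so
  the bound passes to \<open>P\<close>, up to the angle at the closing corner.\<close>

section \<open>Angles between vectors\<close>

definition vector_angle :: "'a::real_inner \<Rightarrow> 'a \<Rightarrow> real" where
  "vector_angle v w = arccos (v \<bullet> w / (norm v * norm w))"

lemma cosine_bounds:
  fixes v w :: "'a::real_inner"
  shows "-1 \<le> v \<bullet> w / (norm v * norm w)" "v \<bullet> w / (norm v * norm w) \<le> 1"
proof -
  have "\<bar>v \<bullet> w / (norm v * norm w)\<bar> \<le> 1"
    using Cauchy_Schwarz_ineq2[of v w] by (auto simp: abs_mult divide_le_eq_1)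
  then show "-1 \<le> v \<bullet> w / (norm v * norm w)" "v \<bullet> w / (norm v * norm w) \<le> 1"
    by linarith+
qed

lemma cos_vector_angle: "cos (vector_angle v w) = v \<bullet> w / (norm v * norm w)"
  unfolding vector_angle_def using cosine_bounds cos_arccos by blast

lemma vector_angle_nonneg: "0 \<le> vector_angle v w"
  unfolding vector_angle_def using cosine_bounds arccos_lbound by blast

lemma vector_angle_le_pi: "vector_angle v w \<le> pi"
  unfolding vector_angle_def using cosine_bounds arccos_ubound by blast

lemma vector_angle_zero [simp]: "vector_angle 0 w = pi / 2" "vector_angle v 0 = pi / 2"
  by (simp_all add: vector_angle_def)

lemma vector_angle_eqI:
  assumes "0 \<le> x" "x \<le> pi" "cos x = v \<bullet> w / (norm v * norm w)"
  shows "vector_angle v w = x"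
  unfolding vector_angle_def using assms by (metis arccos_cos)

lemma sin_vector_angle:
  assumes "v \<noteq> 0" "w \<noteq> 0"
  shows "sin (vector_angle v w) = sqrt ((norm v)\<^sup>2 * (norm w)\<^sup>2 - (v \<bullet> w)\<^sup>2) / (norm v * norm w)"
proof -
  have "sin (vector_angle v w) = sqrt (1 - (v \<bullet> w / (norm v * norm w))\<^sup>2)"
    unfolding vector_angle_def using cosine_bounds sin_arccos by blast
  also have "1 - (v \<bullet> w / (norm v * norm w))\<^sup>2
      = ((norm v)\<^sup>2 * (norm w)\<^sup>2 - (v \<bullet> w)\<^sup>2) / (norm v * norm w)\<^sup>2"
    using assms by (simp add: field_simps)
  finally show ?thesis
    by (simp add: real_sqrt_divide)
qed

text \<open>Cauchy-Schwarz for the components of \<open>u\<close> and \<open>w\<close> orthogonal to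
  \<open>v\<close> says that the cosine of the sum of the two angles is at most the cosine of the
  angle between \<open>u\<close> and \<open>w\<close>; cosine decreases on
  \<open>[0, pi]\<close>.\<close>

lemma vector_angle_triangle:
  "vector_angle u w \<le> vector_angle u v + vector_angle v w"
proof (cases "u = 0 \<or> v = 0 \<or> w = 0")
  case True
  then show ?thesis
    using vector_angle_nonneg[of u v] vector_angle_nonneg[of v w] vector_angle_le_pi[of u w] by auto
next
  case False
  then have nz: "norm u > 0" "norm v > 0" "norm w > 0" by auto
  show ?thesis
  proof (cases "vector_angle u v + vector_angle v w \<le> pi")
    case True
    \<comment> \<open>\<open>x\<close> and \<open>y\<close> are the components of \<open>u\<close>
      and \<open>w\<close> orthogonal to \<open>v\<close>, scaled by the square of
      \<open>norm v\<close> to avoid division. \<open>A\<close> and \<open>B\<close> are the sines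
      of the two angles times the norms of their sides.\<close>
    define x where "x = (norm v)\<^sup>2 *\<^sub>R u - (u \<bullet> v) *\<^sub>R v"
    define y where "y = (norm v)\<^sup>2 *\<^sub>R w - (v \<bullet> w) *\<^sub>R v"
    define A where "A = sqrt ((norm u)\<^sup>2 * (norm v)\<^sup>2 - (u \<bullet> v)\<^sup>2)"
    define B where "B = sqrt ((norm v)\<^sup>2 * (norm w)\<^sup>2 - (v \<bullet> w)\<^sup>2)"
    have "x \<bullet> x = (norm v)\<^sup>2 * ((norm u)\<^sup>2 * (norm v)\<^sup>2 - (u \<bullet> v)\<^sup>2)"
      by (simp only: x_def inner_diff_left inner_diff_right inner_scaleR_left inner_scaleR_right)
        (simp add: inner_commute[of v u] dot_square_norm algebra_simps power2_eq_square)
    then have nx: "norm x = norm v * A"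
      using nz by (simp add: norm_eq_sqrt_inner[of x] real_sqrt_mult A_def)
    have "y \<bullet> y = (norm v)\<^sup>2 * ((norm v)\<^sup>2 * (norm w)\<^sup>2 - (v \<bullet> w)\<^sup>2)"
      by (simp only: y_def inner_diff_left inner_diff_right inner_scaleR_left inner_scaleR_right)
        (simp add: inner_commute[of w v] dot_square_norm algebra_simps power2_eq_square)
    then have ny: "norm y = norm v * B"
      using nz by (simp add: norm_eq_sqrt_inner[of y] real_sqrt_mult B_def)
    have xy: "x \<bullet> y = (norm v)\<^sup>2 * ((norm v)\<^sup>2 * (u \<bullet> w) - (u \<bullet> v) * (v \<bullet> w))"
      by (simp add: x_def y_def inner_diff_left inner_diff_right inner_commute[of w v]
          dot_square_norm algebra_simps power2_eq_square)
    have "- (norm x * norm y) \<le> x \<bullet> y"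
      using Cauchy_Schwarz_ineq2[of x y] by linarith
    then have "(norm v)\<^sup>2 * (- (A * B)) \<le> (norm v)\<^sup>2 * ((norm v)\<^sup>2 * (u \<bullet> w) - (u \<bullet> v) * (v \<bullet> w))"
      unfolding nx ny xy by (simp add: power2_eq_square algebra_simps)
    then have "(u \<bullet> v) * (v \<bullet> w) - A * B \<le> (norm v)\<^sup>2 * (u \<bullet> w)"
      using nz mult_left_le_imp_le[of "(norm v)\<^sup>2" "- (A * B)"] by force
    then have "((u \<bullet> v) * (v \<bullet> w) - A * B) / (norm u * (norm v)\<^sup>2 * norm w)
        \<le> (norm v)\<^sup>2 * (u \<bullet> w) / (norm u * (norm v)\<^sup>2 * norm w)"
      using nz by (intro divide_right_mono) auto
    then have "cos (vector_angle u v + vector_angle v w) \<le> cos (vector_angle u w)"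
      using nz False
      by (simp add: cos_add cos_vector_angle sin_vector_angle A_def B_def
          diff_divide_distrib power2_eq_square mult_ac)
    then show ?thesis
      using True by (subst (asm) cos_mono_le_eq) (auto simp: vector_angle_nonneg vector_angle_le_pi)
  qed (use vector_angle_le_pi[of u w] in linarith)
qed

text \<open>The direction \<open>v + w\<close> lies in the plane angle spanned by \<open>v\<close>
  and \<open>w\<close> and divides it. The value \<open>pi / 2\<close> for a zero vector keeps this
  true unless both vectors vanish.\<close>

lemma vector_angle_add:
  assumes "v \<noteq> 0 \<or> w \<noteq> 0"
  shows "vector_angle v (v + w) + vector_angle (v + w) w = vector_angle v w"
proof -
  have refl: "vector_angle z z = 0" if "z \<noteq> 0" for z :: 'a
    using that by (intro vector_angle_eqI) (auto simp: power2_norm_eq_inner[symmetric] power2_eq_square)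
  consider "v = 0 \<or> w = 0" | "v \<noteq> 0" "w \<noteq> 0" "v + w = 0" | "v \<noteq> 0" "w \<noteq> 0" "v + w \<noteq> 0"
    by blast
  then show ?thesis
  proof cases
    case 1
    then show ?thesis using assms refl by auto
  next
    case 2
    then have "w = - v" by (metis add_eq_0_iff)
    \<comment> \<open>At a full reversal the two angles with the zero vector, \<open>pi / 2\<close>
      each, add up to \<open>pi\<close>.\<close>
    then have "vector_angle v w = pi"
      using 2 by (intro vector_angle_eqI) (auto simp: power2_norm_eq_inner[symmetric] power2_eq_square)
    then show ?thesis using 2 by simp
  next
    case 3
    define a b s k where "a = norm v" "b = norm w" "s = norm (v + w)" "k = v \<bullet> w"
    note defs = this
    have pos: "a > 0" "b > 0" "s > 0" using 3 by (auto simp: defs)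
    have vs: "v \<bullet> (v + w) = a\<^sup>2 + k" and sw: "(v + w) \<bullet> w = b\<^sup>2 + k"
      by (auto simp: defs inner_add_left inner_add_right power2_norm_eq_inner)
    have s2: "s\<^sup>2 = a\<^sup>2 + b\<^sup>2 + 2 * k"
      by (auto simp: defs inner_add_left inner_add_right power2_norm_eq_inner inner_commute[of w v])
    have k: "\<bar>k\<bar> \<le> a * b"
      using Cauchy_Schwarz_ineq2[of v w] by (simp add: defs)
    \<comment> \<open>\<open>D\<close> is the Gram determinant of \<open>v\<close> and
      \<open>w\<close>. By \<open>gram\<close> it is also that of \<open>v, v + w\<close> and of
      \<open>v + w, w\<close>, so both sines have the same numerator.\<close>
    define D where "D = a\<^sup>2 * b\<^sup>2 - k\<^sup>2"
    have D: "D \<ge> 0"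
      using power_mono[OF k, of 2] by (simp add: D_def power_mult_distrib)
    have gram: "a\<^sup>2 * s\<^sup>2 - (a\<^sup>2 + k)\<^sup>2 = D" "s\<^sup>2 * b\<^sup>2 - (b\<^sup>2 + k)\<^sup>2 = D"
      unfolding s2 D_def by algebra+
    let ?x = "vector_angle v (v + w)" and ?y = "vector_angle (v + w) w"
    have cosx: "cos ?x = (a\<^sup>2 + k) / (a * s)" and cosy: "cos ?y = (b\<^sup>2 + k) / (s * b)"
      by (simp_all only: cos_vector_angle vs sw) (simp_all add: defs)
    have sinx: "sin ?x = sqrt D / (a * s)" and siny: "sin ?y = sqrt D / (s * b)"
      using sin_vector_angle[of v "v + w"] sin_vector_angle[of "v + w" w] 3 gram
      by (simp_all only: vs sw defs(1-3)[symmetric] not_False_eq_True)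
    \<comment> \<open>A nonnegative sum of cosines forces \<open>?x + ?y \<le> pi\<close>, the range
      where the cosine determines the angle.\<close>
    have "0 \<le> (a + b) * (a * b + k) / (a * b * s)"
      using pos k by (intro divide_nonneg_nonneg mult_nonneg_nonneg) auto
    also have "\<dots> = cos ?x + cos ?y"
      using pos unfolding cosx cosy by (simp add: field_simps power2_eq_square)
    finally have "cos (pi - ?y) \<le> cos ?x"
      by simp
    then have le: "?x + ?y \<le> pi"
      by (subst (asm) cos_mono_le_eq) (auto simp: vector_angle_nonneg vector_angle_le_pi)
    have "cos (?x + ?y) = ((a\<^sup>2 + k) * (b\<^sup>2 + k) - D) / (a * b * s\<^sup>2)"
      using D unfolding cos_add cosx cosy sinx siny
      by (simp add: diff_divide_distrib power2_eq_square mult_ac)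
    also have "(a\<^sup>2 + k) * (b\<^sup>2 + k) - D = k * s\<^sup>2"
      unfolding s2 D_def by algebra
    finally have "cos (?x + ?y) = k / (a * b)"
      using pos by simp
    then show ?thesis
      using le by (intro vector_angle_eqI[symmetric]) (auto simp: vector_angle_nonneg defs)
  qed
qed

lemma tendsto_vector_angle:
  fixes f g :: "'b \<Rightarrow> 'a::real_inner"
  assumes "(f \<longlongrightarrow> v) F" "(g \<longlongrightarrow> w) F" "v \<noteq> 0" "w \<noteq> 0"
  shows "((\<lambda>x. vector_angle (f x) (g x)) \<longlongrightarrow> vector_angle v w) F"
  unfolding vector_angle_def
  by (rule continuous_on_tendsto_compose[OF continuous_on_arccos'])
    (auto intro!: tendsto_intros assms simp: assms cosine_bounds always_eventually)

section \<open>The rotation of an open polygonal\<close>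

text \<open>The vertices are \<open>a # xs\<close> and \<open>u\<close> is an incoming direction. For \<open>u = 0\<close> the first angle is the
  junk value \<open>arccos 0 = pi / 2\<close>; the triangle inequality holds for that value too, so degenerate
  segments need no separate treatment when vertices are removed.\<close>

fun turning_from :: "'a::real_inner \<Rightarrow> 'a \<Rightarrow> 'a list \<Rightarrow> real" where
  "turning_from u a [] = 0"
| "turning_from u a (x # xs) = vector_angle u (x - a) + turning_from (x - a) x xs"

lemma turning_from_nonneg: "0 \<le> turning_from u a xs"
  by (induction u a xs rule: turning_from.induct) (auto simp: vector_angle_nonneg)

text \<open>Only the first angle depends on the incoming direction.\<close>

lemma turning_from_change_direction:
  "turning_from u a xs \<le> vector_angle u v + turning_from v a xs"
  using vector_angle_triangle[of u _ v] by (cases xs) (auto simp: vector_angle_nonneg)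

text \<open>The new segment \<open>z - a\<close> splits the angle at \<open>y\<close> in two by
  \<open>vector_angle_add\<close>. Each half pays, by the triangle inequality, for the change of
  direction at one end of the new segment.\<close>

lemma turning_from_delete_vertex: "turning_from u a xs \<le> turning_from u a (y # xs)"
proof (cases xs)
  case Nil
  then show ?thesis by (simp add: vector_angle_nonneg)
next
  case (Cons z zs)
  let ?v = "y - a" and ?w = "z - y"
  have s: "z - a = ?v + ?w" by simp
  have "vector_angle u (z - a) + turning_from (z - a) z zs
      \<le> vector_angle u ?v + vector_angle ?v ?w + turning_from ?w z zs"
  proof (cases "?v = 0 \<and> ?w = 0")
    case True
    then show ?thesis by simp
  next
    case False
    then have "vector_angle ?v (z - a) + vector_angle (z - a) ?w = vector_angle ?v ?w"
      unfolding s by (intro vector_angle_add) blast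
    then show ?thesis
      using vector_angle_triangle[of u "z - a" ?v]
        turning_from_change_direction[of "z - a" z zs ?w] by linarith
  qed
  then show ?thesis by (simp add: Cons)
qed

lemma turning_from_subseq:
  assumes "subseq xs ys"
  shows "turning_from u a xs \<le> turning_from u a ys"
  using assms
proof (induction arbitrary: u a rule: list_emb.induct)
  case (list_emb_Nil ys)
  then show ?case by (simp add: turning_from_nonneg)
next
  case (list_emb_Cons xs ys y)
  then show ?case using turning_from_delete_vertex order_trans by blast
next
  case (list_emb_Cons2 x y xs ys)
  then show ?case by simp
qed

section \<open>Comparison of the recursive turning sum with the rotation\<close>

lemma turning_from_eq_sum:
  "turning_from (b - a) b xs
    = (\<Sum>i<length xs. vector_angle (segment (a # b # xs) i) (segment (a # b # xs) (Suc i)))"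
proof (induction xs arbitrary: a b)
  case (Cons x xs)
  have "segment (a # b # x # xs) (Suc i) = segment (b # x # xs) i" for i
    by (simp add: segment_def)
  then show ?case
    by (simp add: Cons sum.lessThan_Suc_shift del: sum.lessThan_Suc)
      (simp add: segment_def)
qed simp

lemma turning_angle_eq_vector_angle:
  "turning_angle P i = vector_angle (segment P i) (segment P (next_segment P i))"
  by (simp add: turning_angle_def vector_angle_def Let_def)

lemma turning_angle_nonneg: "0 \<le> turning_angle P i"
  and turning_angle_le_pi: "turning_angle P i \<le> pi"
  by (simp_all add: turning_angle_eq_vector_angle vector_angle_nonneg vector_angle_le_pi)

lemma finite_corners: "finite (corners P)"
  by (rule finite_subset[of _ "{..<n_segments P}"]) (auto simp: corners_def)

text \<open>Both sides contain the angles at the inner vertices. Besides these,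
  \<open>turning_from 0\<close> counts \<open>pi / 2\<close> at the start, while the rotation counts
  at most a closing angle between 0 and \<open>pi\<close>.\<close>

lemma rotation_bounds:
  shows "turning_from 0 a xs \<le> rotation (a # xs) + pi / 2"
    and "rotation (a # xs) \<le> turning_from 0 a xs + pi / 2"
proof -
  have "turning_from 0 a xs \<le> rotation (a # xs) + pi / 2 \<and>
    rotation (a # xs) \<le> turning_from 0 a xs + pi / 2"
  proof (cases xs)
    case Nil
    then show ?thesis by (simp add: rotation_def corners_def n_segments_def)
  next
    case (Cons b ys)
    let ?P = "a # b # ys"
    have "(\<Sum>i<length ys. turning_angle ?P i) = turning_from (b - a) b ys"
      unfolding turning_from_eq_sum
      by (intro sum.cong) (auto simp: turning_angle_eq_vector_angle next_segment_def n_segments_def)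
    then have eq: "turning_from 0 a xs = pi / 2 + (\<Sum>i<length ys. turning_angle ?P i)"
      by (simp add: Cons)
    have "(\<Sum>i<length ys. turning_angle ?P i) \<le> rotation ?P"
      unfolding rotation_def
      by (intro sum_mono2 finite_corners) (auto simp: corners_def n_segments_def turning_angle_nonneg)
    \<comment> \<open>The additional index \<open>length ys\<close> is the possible closing
      corner.\<close>
    moreover have "rotation ?P \<le> (\<Sum>i<Suc (length ys). turning_angle ?P i)"
      unfolding rotation_def
      by (intro sum_mono2) (auto simp: corners_def n_segments_def turning_angle_nonneg)
    ultimately show ?thesis
      using turning_angle_le_pi[of ?P "length ys"] eq unfolding Cons by simp
  qed
  then show "turning_from 0 a xs \<le> rotation (a # xs) + pi / 2"
    and "rotation (a # xs) \<le> turning_from 0 a xs + pi / 2" by auto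
qed

section \<open>Comparison of the \<open>q\<close>-rotation and the \<open>p\<close>-rotation\<close>

lemma le_tan:
  fixes x :: real
  assumes "0 \<le> x" "x < pi / 2"
  shows "x \<le> tan x"
proof -
  have "tan 0 - 0 \<le> tan x - x"
  proof (rule DERIV_nonneg_imp_nondecreasing[OF assms(1)])
    fix y assume y: "0 \<le> y" "y \<le> x"
    then have "cos y > 0" using assms by (intro cos_gt_zero_pi) auto
    then have "((\<lambda>y. tan y - y) has_real_derivative inverse ((cos y)\<^sup>2) - 1) (at y)"
      by (auto intro!: derivative_eq_intros)
    moreover have "inverse ((cos y)\<^sup>2) - 1 \<ge> 0"
      using \<open>cos y > 0\<close> by (simp add: one_le_inverse_iff abs_square_le_1)
    ultimately show "\<exists>d. ((\<lambda>y. tan y - y) has_real_derivative d) (at y) \<and> 0 \<le> d"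
      by blast
  qed
  then show ?thesis by simp
qed

text \<open>This is \<open>x powr q \<le> 1 + x powr p\<close> divided by \<open>x\<close>, since an
  arc of angle \<theta> and curvature \<open>x\<close> has length
  \<open>\<theta> / x\<close>.\<close>

lemma powr_le_inverse_plus_powr:
  fixes x q p :: real
  assumes "0 < x" "1 \<le> q" "q \<le> p"
  shows "x powr (q - 1) \<le> 1 / x + x powr (p - 1)"
proof (cases "x \<le> 1")
  case True
  then have "x powr (q - 1) \<le> x powr (- 1)"
    using assms by (intro powr_mono') auto
  also have "\<dots> = 1 / x" using assms by (simp add: powr_minus_divide)
  finally show ?thesis by (simp add: add_increasing2)
next
  case False
  then have "x powr (q - 1) \<le> x powr (p - 1)"
    using assms by (intro powr_mono) auto
  then show ?thesis using assms by (simp add: add_increasing)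
qed

text \<open>The slack is the length \<open>\<theta> / \<kappa>\<close> of the arc of curvature \<open>\<kappa>\<close>, at most \<open>r\<close> because
  \<open>\<theta> / 2 \<le> tan (\<theta> / 2)\<close>.\<close>

lemma corner_term_le:
  fixes \<theta> r q p :: real
  assumes "0 \<le> \<theta>" "\<theta> < pi" "0 < r" "1 \<le> q" "q \<le> p"
  shows "\<theta> * (tan (\<theta> / 2) / (r / 2)) powr (q - 1)
    \<le> r + \<theta> * (tan (\<theta> / 2) / (r / 2)) powr (p - 1)"
proof (cases "\<theta> = 0")
  case False
  define k where "k = tan (\<theta> / 2) / (r / 2)"
  have tan: "\<theta> / 2 \<le> tan (\<theta> / 2)"
    using assms by (intro le_tan) auto
  then have "k > 0"
    using assms False by (auto simp: k_def)
  have "\<theta> / k \<le> r"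
    using tan assms False by (simp add: k_def field_simps)
  moreover have "\<theta> * k powr (q - 1) \<le> \<theta> * (1 / k + k powr (p - 1))"
    using assms \<open>k > 0\<close> by (intro mult_left_mono powr_le_inverse_plus_powr) auto
  ultimately show ?thesis
    unfolding k_def[symmetric] by (simp add: distrib_left)
qed (use assms in auto)

lemma corner_size_pos:
  assumes "nondegenerate P" "i \<in> corners P"
  shows "0 < corner_size P i"
proof -
  have "i < n_segments P" "next_segment P i < n_segments P"
    using assms(2) by (auto simp: corners_def next_segment_def)
  then show ?thesis
    using assms(1) by (auto simp: corner_size_def nondegenerate_def segment_def)
qed

text \<open>Each corner is charged to its incoming segment, so no segment is charged twice, even if
  the polygonal is closed.\<close>

lemma sum_corner_size_le: "(\<Sum>i\<in>corners P. corner_size P i) \<le> polygonal_length P"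
proof -
  have "(\<Sum>i\<in>corners P. corner_size P i) \<le> (\<Sum>i\<in>corners P. norm (segment P i))"
    by (intro sum_mono) (simp add: corner_size_def)
  also have "\<dots> \<le> polygonal_length P"
    unfolding polygonal_length_def by (intro sum_mono2) (auto simp: corners_def)
  finally show ?thesis .
qed

lemma p_rotation_le:
  assumes "nondegenerate P" "1 \<le> q" "q < p"
  shows "p_rotation q P \<le> ereal (polygonal_length P) + p_rotation p P"
proof (cases "\<exists>i\<in>corners P. turning_angle P i = pi")
  case True
  \<comment> \<open>Since \<open>p > 1\<close>, a turning angle \<open>pi\<close> makes the right
    side infinite.\<close>
  then show ?thesis using assms by (simp add: p_rotation_def)
next
  case False
  then have lt: "turning_angle P i < pi" if "i \<in> corners P" for i
    using that turning_angle_le_pi[of P i] by fastforce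
  define t where "t s i = turning_angle P i *
    (tan (turning_angle P i / 2) / (corner_size P i / 2)) powr (s - 1)" for s i
  have "(\<Sum>i\<in>corners P. t q i) \<le> (\<Sum>i\<in>corners P. corner_size P i + t p i)"
    unfolding t_def using assms lt corner_size_pos
    by (intro sum_mono corner_term_le) (auto simp: turning_angle_nonneg)
  then have le: "(\<Sum>i\<in>corners P. t q i) \<le> polygonal_length P + (\<Sum>i\<in>corners P. t p i)"
    using sum_corner_size_le[of P] by (simp add: sum.distrib)
  \<comment> \<open>For \<open>q = 1\<close> the power is 1 only where the curvature is positive,
    because \<open>0 powr 0 = 0\<close>; at a zero angle the term vanishes anyway.\<close>
  have rot: "rotation P = (\<Sum>i\<in>corners P. t q i)" if "q = 1"
    unfolding rotation_def
  proof (intro sum.cong refl)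
    fix i assume i: "i \<in> corners P"
    show "turning_angle P i = t q i"
    proof (cases "turning_angle P i = 0")
      case nz: False
      then have "0 < turning_angle P i / 2" "turning_angle P i / 2 < pi / 2"
        using lt[OF i] turning_angle_nonneg[of P i] by auto
      then have "tan (turning_angle P i / 2) > 0" by (rule tan_gt_zero)
      then show ?thesis
        using that corner_size_pos[OF assms(1) i] by (simp add: t_def)
    qed (simp add: t_def)
  qed
  have "p_rotation q P = ereal (\<Sum>i\<in>corners P. t q i)"
    using False rot by (simp add: p_rotation_def t_def)
  moreover have "p_rotation p P = ereal (\<Sum>i\<in>corners P. t p i)"
    using False assms by (simp add: p_rotation_def t_def)
  ultimately show ?thesis using le by simp
qed

section \<open>Passage from polygonals to the curve\<close>

lemma p_curvature_le:
  assumes "rectifiable_curve c L" "1 \<le> q" "q < p"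
  shows "p_curvature q c L \<le> curve_length c 0 L + p_curvature p c L"
proof (cases "\<exists>ts. is_partition 0 L ts")
  case False
  \<comment> \<open>For \<open>L < 0\<close> no polygonal is inscribed and both infima are infinite;
    the length is then minus infinity, but its sum with infinity is infinity in
    \<open>ereal\<close>.\<close>
  then show ?thesis
    by (auto simp: p_curvature_def inscribed_def top_ereal_def)
next
  case True
  have len: "ereal (polygonal_length (map c ts)) \<le> curve_length c 0 L" if "is_partition 0 L ts" for ts
    unfolding curve_length_def using that by (intro SUP_upper) auto
  obtain K where K: "curve_length c 0 L = ereal K"
  proof -
    have "curve_length c 0 L \<noteq> \<infinity>" "curve_length c 0 L \<noteq> - \<infinity>"
      using assms(1) True len by (force simp: rectifiable_curve_def)+
    then show thesis using that by (cases "curve_length c 0 L") auto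
  qed
  \<comment> \<open>With the finite length moved to the left, it suffices to bound the liminf along
    each sequence admissible for \<open>p\<close>, which is also admissible for
    \<open>q\<close>.\<close>
  have "p_curvature q c L - ereal K \<le> p_curvature p c L"
    unfolding p_curvature_def[of p]
  proof (rule Inf_greatest, clarify)
    fix ts :: "nat \<Rightarrow> real list"
    assume ts: "\<forall>h. inscribed c L (ts h)" "(\<lambda>h. modulus c (ts h)) \<longlonglongrightarrow> 0"
    have "p_curvature q c L \<le> liminf (\<lambda>h. p_rotation q (map c (ts h)))"
      unfolding p_curvature_def using ts by (intro Inf_lower) auto
    also have "\<dots> \<le> liminf (\<lambda>h. ereal K + p_rotation p (map c (ts h)))"
    proof (intro Liminf_mono always_eventually allI)
      fix h
      have "p_rotation q (map c (ts h))
          \<le> ereal (polygonal_length (map c (ts h))) + p_rotation p (map c (ts h))"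
        using ts assms by (intro p_rotation_le) (auto simp: inscribed_def)
      also have "\<dots> \<le> ereal K + p_rotation p (map c (ts h))"
        using ts len[of "ts h"] by (intro add_right_mono) (auto simp: inscribed_def K)
      finally show "p_rotation q (map c (ts h)) \<le> ereal K + p_rotation p (map c (ts h))" .
    qed
    also have "\<dots> = ereal K + liminf (\<lambda>h. p_rotation p (map c (ts h)))"
      by (rule Liminf_add_ereal_left) auto
    finally show "p_curvature q c L - ereal K \<le> liminf (\<lambda>h. p_rotation p (map c (ts h)))"
      by (simp add: ereal_minus_le add.commute)
  qed
  then show ?thesis by (simp add: K ereal_minus_le add.commute)
qed

section \<open>Approximation by polygonals on given vertices\<close>

lemma tendsto_turning_from:
  fixes X :: "'b \<Rightarrow> 'j \<Rightarrow> 'a::real_inner"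
  assumes "\<And>j. j \<in> set (i # js) \<Longrightarrow> ((\<lambda>h. X h j) \<longlongrightarrow> x j) F"
    and "(u \<longlongrightarrow> v) F" "v \<noteq> 0" "nondegenerate (map x (i # js))"
  shows "((\<lambda>h. turning_from (u h) (X h i) (map (X h) js)) \<longlongrightarrow> turning_from v (x i) (map x js)) F"
  using assms
proof (induction js arbitrary: i u v)
  case (Cons j js)
  have diff: "((\<lambda>h. X h j - X h i) \<longlongrightarrow> x j - x i) F"
    using Cons.prems(1) by (intro tendsto_diff) auto
  have nd: "x j \<noteq> x i" "nondegenerate (map x (j # js))"
    using Cons.prems(4) by (force simp: nondegenerate_def n_segments_def)+
  have "((\<lambda>h. vector_angle (u h) (X h j - X h i)) \<longlongrightarrow> vector_angle v (x j - x i)) F"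
    using nd Cons.prems diff by (intro tendsto_vector_angle) auto
  moreover have "((\<lambda>h. turning_from (X h j - X h i) (X h j) (map (X h) js))
      \<longlongrightarrow> turning_from (x j - x i) (x j) (map x js)) F"
    using Cons.prems(1) diff nd by (intro Cons.IH) auto
  ultimately show ?case by (simp add: tendsto_add)
qed simp

text \<open>The angle is not continuous at the direction 0, but here the incoming direction is
  constantly 0 and the first angle constantly \<open>pi / 2\<close>.\<close>

lemma tendsto_turning_from_zero:
  fixes X :: "'b \<Rightarrow> 'j \<Rightarrow> 'a::real_inner"
  assumes "\<And>j. j \<in> set (i # js) \<Longrightarrow> ((\<lambda>h. X h j) \<longlongrightarrow> x j) F"
    and "nondegenerate (map x (i # js))"
  shows "((\<lambda>h. turning_from 0 (X h i) (map (X h) js)) \<longlongrightarrow> turning_from 0 (x i) (map x js)) F"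
proof (cases js)
  case (Cons j ks)
  have nd: "x j \<noteq> x i" "nondegenerate (map x (j # ks))"
    using assms(2) unfolding Cons by (force simp: nondegenerate_def n_segments_def)+
  have "((\<lambda>h. turning_from (X h j - X h i) (X h j) (map (X h) ks))
      \<longlongrightarrow> turning_from (x j - x i) (x j) (map x ks)) F"
    using assms(1) nd Cons by (intro tendsto_turning_from tendsto_diff) auto
  then show ?thesis by (simp add: Cons tendsto_add)
qed simp

section \<open>Partition points preceding given parameters\<close>

text \<open>Rounding down to a partition point preserves order and moves the point of the curve by
  at most the modulus.\<close>

definition previous_vertex :: "real list \<Rightarrow> real \<Rightarrow> real" where
  "previous_vertex ts s = Max {t \<in> set ts. t \<le> s}"

context
  fixes ts :: "real list" and L :: real
  assumes part: "is_partition 0 L ts"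
begin

lemma zero_in_partition: "0 \<in> set ts"
  using part by (cases ts) (auto simp: is_partition_def)

lemma previous_vertex_in:
  assumes "0 \<le> s"
  shows "previous_vertex ts s \<in> {t \<in> set ts. t \<le> s}"
  unfolding previous_vertex_def using zero_in_partition assms by (intro Max_in) auto

lemma previous_vertex_mono:
  assumes "0 \<le> s" "s \<le> s'"
  shows "previous_vertex ts s \<le> previous_vertex ts s'"
  unfolding previous_vertex_def using zero_in_partition assms by (intro Max_mono) auto

text \<open>The initial vertex must stay in place, because \<open>turning_from_subseq\<close>
  compares lists with a common start.\<close>

lemma previous_vertex_zero: "previous_vertex ts 0 = 0"
proof -
  have "0 \<le> previous_vertex ts 0"
    unfolding previous_vertex_def using zero_in_partition by (intro Max_ge) auto
  then show ?thesis using previous_vertex_in[of 0] by auto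
qed

lemma partition_subset: "set ts \<subseteq> {0..L}"
proof
  fix t assume "t \<in> set ts"
  then obtain k where "k < length ts" "t = ts ! k"
    by (auto simp: in_set_conv_nth)
  moreover have "sorted ts" "ts ! 0 = 0" "ts ! (length ts - 1) = L"
    using part by (auto simp: is_partition_def hd_conv_nth last_conv_nth strict_sorted_iff)
  ultimately show "t \<in> {0..L}"
    using sorted_nth_mono[of ts 0 k] sorted_nth_mono[of ts k "length ts - 1"] by auto
qed

lemma partition_arc:
  assumes "0 \<le> s" "s \<le> L" "L > 0"
  obtains i where "i < n_segments ts" "s \<in> {ts ! i..ts ! Suc i}" "previous_vertex ts s \<in> {ts ! i..ts ! Suc i}"
proof -
  have ne: "ts \<noteq> []" "ts ! 0 = 0" "ts ! (length ts - 1) = L" and sorted: "sorted_wrt (<) ts"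
    using part by (auto simp: is_partition_def hd_conv_nth last_conv_nth)
  let ?t = "previous_vertex ts s"
  obtain k where k: "k < length ts" "ts ! k = ?t"
    using previous_vertex_in[OF assms(1)] by (auto simp: in_set_conv_nth)
  have le: "?t \<le> s" using previous_vertex_in[OF assms(1)] by auto
  show thesis
  proof (cases "Suc k < length ts")
    case True
    have "s \<le> ts ! Suc k"
    proof (rule ccontr)
      assume "\<not> s \<le> ts ! Suc k"
      then have "ts ! Suc k \<le> ?t"
        unfolding previous_vertex_def using True by (intro Max_ge) auto
      moreover have "ts ! k < ts ! Suc k"
        using sorted True by (simp add: sorted_wrt_nth_less)
      ultimately show False using k by simp
    qed
    then show thesis using True k le by (intro that[of k]) (auto simp: n_segments_def)
  next
    case False
    \<comment> \<open>The previous vertex is the endpoint \<open>L\<close> only for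
      \<open>s = L\<close>; no arc follows it, so the last arc, which ends there, is taken.\<close>
    then have kl: "k = length ts - 1" using k by simp
    then have "?t = L" using k ne by simp
    then have sL: "s = L" using le assms by simp
    have "length ts > 1"
      using ne assms kl by (cases "length ts = 1") (auto simp: Suc_lessI)
    then have "Suc (k - 1) = k" "k - 1 < n_segments ts" using kl by (auto simp: n_segments_def)
    moreover have "ts ! (k - 1) < ts ! k"
      using sorted \<open>length ts > 1\<close> kl by (simp add: sorted_wrt_nth_less)
    ultimately show thesis
      using k sL \<open>?t = L\<close> by (intro that[of "k - 1"]) auto
  qed
qed

lemma dist_previous_vertex_le:
  fixes c :: "real \<Rightarrow> 'a::real_inner"
  assumes "continuous_on {0..L} c" "0 \<le> s" "s \<le> L"
  shows "dist (c (previous_vertex ts s)) (c s) \<le> modulus c ts"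
proof (cases "L > 0")
  case True
  obtain i where i: "i < n_segments ts" "s \<in> {ts ! i..ts ! Suc i}"
      "previous_vertex ts s \<in> {ts ! i..ts ! Suc i}"
    using partition_arc assms True by metis
  have sub: "{ts ! i..ts ! Suc i} \<subseteq> {0..L}"
  proof -
    have "ts ! i \<in> set ts" "ts ! Suc i \<in> set ts"
      using i(1) by (auto simp: n_segments_def)
    then show ?thesis using partition_subset by auto
  qed
  have "compact (c ` {ts ! i..ts ! Suc i})"
    using assms(1) sub by (intro compact_continuous_image) (auto intro: continuous_on_subset)
  then have "dist (c (previous_vertex ts s)) (c s) \<le> diameter (c ` {ts ! i..ts ! Suc i})"
    using i by (intro diameter_bounded_bound compact_imp_bounded) auto
  also have "\<dots> \<le> modulus c ts"
    unfolding modulus_def using i(1) by (intro Max_ge) auto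
  finally show ?thesis .
next
  case False
  then have "s = 0" using assms by simp
  then show ?thesis by (auto simp: modulus_def previous_vertex_zero intro!: Max_ge)
qed

end

lemma tendsto_previous_vertex:
  fixes c :: "real \<Rightarrow> 'a::real_inner"
  assumes "continuous_on {0..L} c" "s \<in> {0..L}"
    and "\<And>h. is_partition 0 L (ts h)" "(\<lambda>h. modulus c (ts h)) \<longlonglongrightarrow> 0"
  shows "(\<lambda>h. c (previous_vertex (ts h) s)) \<longlonglongrightarrow> c s"
  by (rule metric_tendsto_imp_tendsto[OF assms(4)])
    (use assms in \<open>auto intro!: always_eventually dist_previous_vertex_le[THEN order_trans]\<close>)

text \<open>The chosen vertices form a subsequence of \<open>ts\<close>, so passing to them does not
  increase the turning. Rounding down is only weakly monotone; the assumption \<open>ne\<close>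
  excludes repetitions.\<close>

lemma turning_from_previous_vertices_le:
  fixes c :: "real \<Rightarrow> 'a::real_inner"
  assumes ts: "is_partition 0 L ts" and s: "is_partition 0 L (0 # js)"
    and ne: "\<And>i. Suc i < length (0 # js) \<Longrightarrow>
      c (previous_vertex ts ((0 # js) ! Suc i)) \<noteq> c (previous_vertex ts ((0 # js) ! i))"
  shows "turning_from 0 (c 0) (map (\<lambda>t. c (previous_vertex ts t)) js)
    \<le> rotation (map c ts) + pi / 2"
proof -
  let ?p = "previous_vertex ts" and ?s = "0 # js"
  have nonneg: "0 \<le> t" if "t \<in> set ?s" for t
    using partition_subset[OF s] that by auto
  have "sorted_wrt (<) (map ?p ?s)"
    unfolding sorted_wrt_iff_nth_Suc_transp[OF transp_on_less]
  proof (intro allI impI)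
    fix i assume i: "Suc i < length (map ?p ?s)"
    then have "?s ! i < ?s ! Suc i"
      using s by (intro sorted_wrt_nth_less[of "(<)"]) (auto simp: is_partition_def)
    moreover have "0 \<le> ?s ! i"
      using i by (intro nonneg nth_mem) auto
    ultimately have "?p (?s ! i) \<le> ?p (?s ! Suc i)"
      by (intro previous_vertex_mono[OF ts]) auto
    moreover have "?p (?s ! i) \<noteq> ?p (?s ! Suc i)"
      using ne[of i] i by auto
    ultimately have "?p (?s ! i) < ?p (?s ! Suc i)" by simp
    then show "map ?p ?s ! i < map ?p ?s ! Suc i"
      using i by (simp only: nth_map length_map Suc_lessD)
  qed
  moreover have "set (map ?p ?s) \<subseteq> set ts"
    using previous_vertex_in[OF ts] nonneg by auto
  moreover have "sorted ts"
    using ts by (simp add: is_partition_def strict_sorted_iff)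
  ultimately have "subseq (map ?p ?s) ts"
    by (intro sorted_subset_imp_subseq)
  moreover obtain us where us: "ts = 0 # us"
    using ts by (cases ts) (auto simp: is_partition_def)
  ultimately have "subseq (map ?p js) us"
    using previous_vertex_zero[OF ts] by simp
  then have "subseq (map c (map ?p js)) (map c us)"
    by (rule subseq_map)
  then have "turning_from 0 (c 0) (map c (map ?p js)) \<le> turning_from 0 (c 0) (map c us)"
    by (rule turning_from_subseq)
  also have "\<dots> \<le> rotation (map c ts) + pi / 2"
    using rotation_bounds(1)[of "c 0" "map c us"] by (simp add: us)
  finally show ?thesis by (simp add: comp_def)
qed

section \<open>Finiteness of the total curvature\<close>

lemma total_curvature_finite:
  fixes c :: "real \<Rightarrow> 'a::real_inner"
  assumes cont: "continuous_on {0..L} c" and fin: "p_curvature 1 c L < \<infinity>"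
  shows "total_curvature c L < \<infinity>"
proof -
  obtain ts where ts: "\<And>h. inscribed c L (ts h)" "(\<lambda>h. modulus c (ts h)) \<longlonglongrightarrow> 0"
    and lim: "liminf (\<lambda>h. ereal (rotation (map c (ts h)))) < \<infinity>"
    using fin unfolding p_curvature_def p_rotation_def Inf_less_iff by auto
  obtain C where C: "liminf (\<lambda>h. ereal (rotation (map c (ts h)))) < ereal C"
    using ereal_dense2[OF lim] by blast
  \<comment> \<open>The liminf bounds the rotation only for infinitely many \<open>h\<close>; this
    suffices, as everything else below holds eventually.\<close>
  have freq: "\<exists>\<^sub>F h in sequentially. rotation (map c (ts h)) < C"
  proof (rule ccontr)
    assume "\<not> ?thesis"
    then have "\<forall>\<^sub>F h in sequentially. ereal C \<le> ereal (rotation (map c (ts h)))"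
      by (simp add: not_frequently not_less)
    then have "ereal C \<le> liminf (\<lambda>h. ereal (rotation (map c (ts h))))"
      by (rule Liminf_bounded)
    then show False using C by simp
  qed
  have part: "is_partition 0 L (ts h)" for h
    using ts by (simp add: inscribed_def)
  \<comment> \<open>One \<open>pi / 2\<close> is lost in \<open>rotation_bounds\<close> for the
    approximating polygonals and another for the given one.\<close>
  have "rotation (map c s) \<le> C + pi" if s: "inscribed c L s" for s
  proof -
    obtain js where js: "s = 0 # js"
      using s by (cases s) (auto simp: inscribed_def is_partition_def)
    have sp: "is_partition 0 L (0 # js)" and nd: "nondegenerate (map c (0 # js))"
      using s js by (auto simp: inscribed_def)
    define X where "X = (\<lambda>h t. c (previous_vertex (ts h) t))"
    have X: "(\<lambda>h. X h t) \<longlonglongrightarrow> c t" if "t \<in> set (0 # js)" for t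
      unfolding X_def using partition_subset[OF sp] that
      by (intro tendsto_previous_vertex[OF cont _ part ts(2)]) auto
    \<comment> \<open>Consecutive vertices of the given polygonal differ, hence so do, eventually,
      the vertices that converge to them.\<close>
    have "\<forall>\<^sub>F h in sequentially. \<forall>i\<in>{..<length js}. X h ((0 # js) ! Suc i) \<noteq> X h ((0 # js) ! i)"
    proof (intro eventually_ball_finite ballI)
      fix i assume i: "i \<in> {..<length js}"
      have "(\<lambda>h. X h ((0 # js) ! Suc i) - X h ((0 # js) ! i))
          \<longlonglongrightarrow> c ((0 # js) ! Suc i) - c ((0 # js) ! i)"
        using i by (intro tendsto_diff X nth_mem) auto
      moreover have "c ((0 # js) ! Suc i) - c ((0 # js) ! i) \<noteq> 0"
        using nd i by (auto simp: nondegenerate_def n_segments_def nth_Cons' split: if_splits)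
      ultimately show "\<forall>\<^sub>F h in sequentially. X h ((0 # js) ! Suc i) \<noteq> X h ((0 # js) ! i)"
        by (auto dest!: tendsto_imp_eventually_ne elim: eventually_mono)
    qed simp
    then have ev: "\<forall>\<^sub>F h in sequentially.
        turning_from 0 (X h 0) (map (X h) js) \<le> rotation (map c (ts h)) + pi / 2"
    proof eventually_elim
      case (elim h)
      then show ?case
        using turning_from_previous_vertices_le[OF part[of h] sp, of c]
        by (simp add: X_def previous_vertex_zero[OF part])
    qed
    have lim: "(\<lambda>h. turning_from 0 (X h 0) (map (X h) js)) \<longlonglongrightarrow> turning_from 0 (c 0) (map c js)"
      using X nd by (intro tendsto_turning_from_zero)
    have "turning_from 0 (c 0) (map c js) \<le> C + pi / 2"
    proof (rule ccontr)
      assume "\<not> ?thesis"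
      then have "\<forall>\<^sub>F h in sequentially. C + pi / 2 < turning_from 0 (X h 0) (map (X h) js)"
        using lim by (intro order_tendstoD(1)) auto
      with ev have "\<forall>\<^sub>F h in sequentially. \<not> rotation (map c (ts h)) < C"
        by eventually_elim simp
      with freq show False by (simp add: frequently_def)
    qed
    then show ?thesis
      using rotation_bounds(2)[of "c 0" "map c js"] by (simp add: js)
  qed
  then have "total_curvature c L \<le> ereal (C + pi)"
    unfolding total_curvature_def by (intro SUP_least) auto
  then show ?thesis by (rule le_less_trans) simp
qed

theorem proposition4p7:
  fixes N :: nat and c :: "real \<Rightarrow> real ^ 'n" and L p :: real
  assumes "N \<ge> 1" and "CARD('n) = N + 1"
    and "0 \<le> L"
    and "rectifiable_curve c L" and "arc_length_parameterized c L"
    and "p > 1" and "p_curvature p c L < \<infinity>"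
  shows "(\<forall>q. 1 \<le> q \<and> q < p \<longrightarrow>
            p_curvature q c L < \<infinity> \<and>
            p_curvature q c L \<le> curve_length c 0 L + p_curvature p c L) \<and>
         total_curvature c L < \<infinity>"
proof -
  have sum: "curve_length c 0 L + p_curvature p c L < \<infinity>"
    using assms(4,7) by (simp add: rectifiable_curve_def)
  have le: "p_curvature q c L \<le> curve_length c 0 L + p_curvature p c L" if "1 \<le> q" "q < p" for q
    using p_curvature_le[OF assms(4) that] .
  then have fin: "p_curvature q c L < \<infinity>" if "1 \<le> q" "q < p" for q
    using that sum by (meson le_less_trans)
  moreover have "total_curvature c L < \<infinity>"
    using assms(4,6) fin[of 1] by (intro total_curvature_finite) (auto simp: rectifiable_curve_def)
  ultimately show ?thesis using le by blast
qed

end
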